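(* There exists a universal constant $C>0$ such that the following holds. Let $p_1,\dots,p_n\in[0,1]$, let $X$ have distribution $\mathrm{Bin}(p_1,\dots,p_n)$, let $d=p_1+\dots+p_n>0$ and $p_{\max}=\max_i p_i\ (\ge d/n)$, and let $Y$ be a Poisson random variable with mean $d$. Then for any integer $k$ satisfying $2d\le k\le (d/p_{\max})^{2/5}/C$, we have $$\left|\frac{\mathbb P(X=k)}{\mathbb P(Y=k)}-1\right|\le C\,\frac{p_{\max}k^{5/2}}{d}$$ and $$\mathbb P(X>k)\le C\left(\frac dk+\frac{p_{\max}k^{5/2}}{d}\right)\mathbb P(X=k).$$
   Context: $\mathrm{Bin}(p_1,\dots,p_n)$ denotes the law of a sum of independent Bernoulli random variables with parameters $p_1,\dots,p_n$. *)

theory Defs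
  imports "HOL-Probability.Probability"
begin

text \<open>
  The law \<open>Bin(p\<^sub>1, \<dots>, p\<^sub>n)\<close>: under the product distribution \<^const>\<open>Pi_pmf\<close> the coordinates
  \<open>\<omega> i\<close> are independent, with \<open>\<omega> i\<close> Bernoulli with parameter \<open>p i\<close>. The values
  \<open>p i\<close> are meant to lie in \<open>[0,1]\<close>, as \<^const>\<open>bernoulli_pmf\<close> clamps its parameter to that interval.
\<close>

definition Bin_pmf :: "nat \<Rightarrow> (nat \<Rightarrow> real) \<Rightarrow> nat pmf" where
  "Bin_pmf n p =
     map_pmf (\<lambda>\<omega>. \<Sum>i=1..n. of_bool (\<omega> i)) (Pi_pmf {1..n} False (\<lambda>i. bernoulli_pmf (p i)))"

end

theory Submission
  imports Defs
begin

text \<open>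
  Let \<open>c j = P(X = j)\<close> be the coefficients of the generating polynomial
  \<open>G = (\<Prod>i. 1 - p\<^sub>i + p\<^sub>i x)\<close>, and write \<open>m\<close> for \<open>p\<^sub>m\<^sub>a\<^sub>x\<close>. Comparing coefficients in
  \<open>G' = (\<Sum>i. p\<^sub>i G\<^sub>i)\<close>, where \<open>G\<^sub>i\<close> omits the \<open>i\<close>-th factor, gives
  \<open>(d - m j) c j \<le> (j + 1) c (j + 1) \<le> d / (1 - m) * c j\<close>. Iterating from
  \<open>c 0 = (\<Prod>i. 1 - p\<^sub>i)\<close>, which is \<open>exp (-d)\<close> up to a factor \<open>1 - 2 m d\<close>, compares \<open>c k\<close> with the
  Poisson weight up to a relative error of order \<open>m k\<^sup>2 / d\<close>. The upper recursion also makes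
  the tail beyond \<open>k\<close> decay geometrically with ratio of order \<open>d / k\<close>.
\<close>

section \<open>Generating polynomials of sums of independent Bernoulli variables\<close>

definition bernoulli_gf :: "('a \<Rightarrow> real) \<Rightarrow> 'a set \<Rightarrow> real poly" where
  "bernoulli_gf p A = (\<Prod>i\<in>A. [:1 - p i, p i:])"

lemma pmf_map_Suc: "pmf (map_pmf Suc M) k = (case k of 0 \<Rightarrow> 0 | Suc j \<Rightarrow> pmf M j)"
  by (cases k) (auto simp: pmf_map_inj' pmf_eq_0_set_pmf)

text \<open>Conditioning on a new coordinate \<open>a\<close> either shifts the law of the remaining
  sum by \<open>Suc\<close> or leaves it unchanged. On coefficients this is multiplication by the
  factor \<open>[:1 - p a, p a:]\<close>.\<close>

lemma pmf_sum_bernoulli: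
  assumes "finite A" "\<And>i. i \<in> A \<Longrightarrow> 0 \<le> p i \<and> p i \<le> 1"
  shows "pmf (map_pmf (\<lambda>\<omega>. \<Sum>i\<in>A. of_bool (\<omega> i)) (Pi_pmf A False (\<lambda>i. bernoulli_pmf (p i)))) k
         = coeff (bernoulli_gf p A) k"
  using assms
proof (induction A arbitrary: k rule: finite_induct)
  case empty
  then show ?case by (cases k) (auto simp: bernoulli_gf_def)
next
  case (insert a A)
  let ?S = "\<lambda>A \<omega>. (\<Sum>i\<in>A. of_bool (\<omega> i)) :: nat"
  let ?M = "map_pmf (?S A) (Pi_pmf A False (\<lambda>i. bernoulli_pmf (p i)))"
  have S: "?S (insert a A) (f(a := y)) = of_bool y + ?S A f" for f y
  proof -
    have "?S A (f(a := y)) = ?S A f"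
      using insert.hyps by (intro sum.cong) auto
    then show ?thesis
      by (simp only: sum.insert[OF insert.hyps] fun_upd_same)
  qed
  have "map_pmf (?S (insert a A)) (Pi_pmf (insert a A) False (\<lambda>i. bernoulli_pmf (p i)))
      = bernoulli_pmf (p a) \<bind> (\<lambda>y. if y then map_pmf Suc ?M else ?M)"
    unfolding Pi_pmf_insert'[OF insert.hyps] map_bind_pmf map_return_pmf S
    by (intro bind_pmf_cong refl) (auto simp: map_pmf_def bind_assoc_pmf bind_return_pmf)
  then show ?case
    using insert
    by (cases k) (auto simp: pmf_bind pmf_map_Suc bernoulli_gf_def algebra_simps)
qed

lemma coeff_bernoulli_gf_nonneg:
  assumes "\<And>i. i \<in> A \<Longrightarrow> 0 \<le> p i \<and> p i \<le> 1"
  shows "coeff (bernoulli_gf p A) k \<ge> 0"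
  using assms
proof (induction A arbitrary: k rule: infinite_finite_induct)
  case (insert a A)
  then show ?case
    by (cases k) (auto simp: bernoulli_gf_def)
qed (simp_all add: bernoulli_gf_def)

lemma coeff_0_bernoulli_gf: "coeff (bernoulli_gf p A) 0 = (\<Prod>i\<in>A. 1 - p i)"
  by (simp add: bernoulli_gf_def poly_prod flip: poly_0_coeff_0)

lemma Suc_coeff_bernoulli_gf:
  "real (Suc j) * coeff (bernoulli_gf p A) (Suc j) = (\<Sum>i\<in>A. p i * coeff (bernoulli_gf p (A - {i})) j)"
proof -
  have "coeff (pderiv (bernoulli_gf p A)) j = (\<Sum>i\<in>A. p i * coeff (bernoulli_gf p (A - {i})) j)"
    unfolding bernoulli_gf_def pderiv_prod by (simp add: coeff_sum pderiv_pCons)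
  then show ?thesis by (simp add: coeff_pderiv)
qed

lemma bernoulli_gf_remove:
  assumes "finite A" "i \<in> A"
  shows "bernoulli_gf p A = [:1 - p i, p i:] * bernoulli_gf p (A - {i})"
  unfolding bernoulli_gf_def by (rule prod.remove[OF assms])

section \<open>Coefficient recursions under a common bound on the parameters\<close>

locale bernoulli_family =
  fixes p :: "'a \<Rightarrow> real" and A :: "'a set" and m :: real
  assumes fin: "finite A"
    and p_nonneg: "\<And>i. i \<in> A \<Longrightarrow> 0 \<le> p i"
    and p_le: "\<And>i. i \<in> A \<Longrightarrow> p i \<le> m"
    and m_nonneg: "0 \<le> m"
    and m_le: "m \<le> 1 / 2"
begin

definition d :: real where "d = (\<Sum>i\<in>A. p i)"

abbreviation c :: "nat \<Rightarrow> real" where "c \<equiv> coeff (bernoulli_gf p A)"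

abbreviation g :: "'a \<Rightarrow> nat \<Rightarrow> real" where "g i \<equiv> coeff (bernoulli_gf p (A - {i}))"

lemma p_le_1: "i \<in> A \<Longrightarrow> p i \<le> 1"
  using p_le[of i] m_le by linarith

lemma d_nonneg: "0 \<le> d"
  unfolding d_def by (intro sum_nonneg p_nonneg)

lemma c_nonneg: "0 \<le> c k"
  by (intro coeff_bernoulli_gf_nonneg) (auto simp: p_nonneg p_le_1)

lemma g_nonneg: "0 \<le> g i k"
  by (intro coeff_bernoulli_gf_nonneg) (auto simp: p_nonneg p_le_1)

text \<open>Dropping the nonnegative term \<open>p i * g i (j - 1)\<close> from the expansion of
  \<open>c j\<close> along the factor \<open>i\<close> leaves \<open>(1 - p i) * g i j\<close>.
  Hence \<open>g i j\<close> is at most \<open>c j / (1 - m)\<close>, uniformly in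
  \<open>i\<close>.\<close>

lemma c_Suc_le: "real (Suc j) * c (Suc j) \<le> d / (1 - m) * c j"
proof -
  have "p i * g i j \<le> p i * (c j / (1 - m))" if i: "i \<in> A" for i
  proof (rule mult_left_mono)
    have "(1 - m) * g i j \<le> (1 - p i) * g i j"
      using p_le[OF i] g_nonneg by (intro mult_right_mono) auto
    also have "\<dots> \<le> c j"
      unfolding bernoulli_gf_remove[OF fin i]
      using p_nonneg[OF i] g_nonneg by (cases j) auto
    finally show "g i j \<le> c j / (1 - m)"
      using m_le by (simp add: field_simps)
  qed (use p_nonneg i in auto)
  then have "(\<Sum>i\<in>A. p i * g i j) \<le> (\<Sum>i\<in>A. p i * (c j / (1 - m)))"
    by (rule sum_mono)
  also have "\<dots> = d / (1 - m) * c j"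
    by (simp add: d_def sum_distrib_right sum_divide_distrib)
  finally show ?thesis
    by (simp only: Suc_coeff_bernoulli_gf)
qed

text \<open>Expanding \<open>c j\<close> along the factor \<open>i\<close> bounds
  \<open>g i j\<close> below by \<open>c j - m * g i (j - 1)\<close>. Weighted by \<open>p i\<close>
  and summed, the subtracted terms collapse to \<open>m * j * c j\<close> by
  \<open>Suc_coeff_bernoulli_gf\<close> one index lower.\<close>

lemma c_Suc_ge: "(d - m * real j) * c j \<le> real (Suc j) * c (Suc j)"
proof (cases j)
  case 0
  have "p i * c 0 \<le> p i * g i 0" if i: "i \<in> A" for i
    unfolding bernoulli_gf_remove[OF fin i]
    using p_nonneg[OF i] p_le_1[OF i] g_nonneg[of i 0]
    by (intro mult_left_mono) (auto intro: mult_left_le_one_le)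
  then have "(\<Sum>i\<in>A. p i * c 0) \<le> (\<Sum>i\<in>A. p i * g i 0)"
    by (rule sum_mono)
  then show ?thesis
    by (simp only: Suc_coeff_bernoulli_gf 0 d_def of_nat_0 mult_zero_right diff_zero sum_distrib_right)
next
  case (Suc l)
  have "p i * c j - m * (p i * g i l) \<le> p i * g i j" if i: "i \<in> A" for i
  proof -
    have "c j - m * g i l \<le> c j - p i * g i l"
      using p_le[OF i] g_nonneg[of i l] by (simp add: mult_right_mono)
    also have "\<dots> = (1 - p i) * g i j"
      unfolding bernoulli_gf_remove[OF fin i] Suc by simp
    also have "\<dots> \<le> g i j"
      using p_nonneg[OF i] p_le_1[OF i] g_nonneg[of i j] by (auto intro: mult_left_le_one_le)
    finally have "p i * (c j - m * g i l) \<le> p i * g i j"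
      using p_nonneg[OF i] by (rule mult_left_mono)
    then show ?thesis by (simp add: algebra_simps)
  qed
  then have "(\<Sum>i\<in>A. p i * c j - m * (p i * g i l)) \<le> (\<Sum>i\<in>A. p i * g i j)"
    by (rule sum_mono)
  moreover have "(\<Sum>i\<in>A. p i * c j - m * (p i * g i l)) = d * c j - m * (real (Suc l) * c (Suc l))"
    by (simp only: sum_subtractf d_def sum_distrib_right sum_distrib_left Suc_coeff_bernoulli_gf)
  moreover have "\<dots> = (d - m * real j) * c j"
    by (simp add: Suc algebra_simps)
  ultimately show ?thesis
    by (simp only: Suc_coeff_bernoulli_gf)
qed

section \<open>Bounds on the constant coefficient and iteration of the recursions\<close>

lemma c_0_le: "c 0 \<le> exp (- d)"
proof -
  have "(\<Prod>i\<in>A. 1 - p i) \<le> (\<Prod>i\<in>A. exp (- p i))"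
  proof (intro prod_mono conjI)
    show "1 - p i \<le> exp (- p i)" for i
      using exp_ge_add_one_self[of "- p i"] by simp
  qed (use p_le_1 in auto)
  then show ?thesis
    by (simp add: coeff_0_bernoulli_gf d_def sum_negf fin flip: exp_sum)
qed

text \<open>On \<open>[0, 1/2]\<close>, \<open>ln (1 - x)\<close> is at least
  \<open>- x - 2 * x^2\<close>, and the squares \<open>(p i)^2\<close> sum to at most
  \<open>m * d\<close>. So \<open>c 0\<close> loses at most a factor
  \<open>exp (- 2 * m * d)\<close> against \<open>exp (- d)\<close>.\<close>

lemma c_0_ge: "(1 - 2 * m * d) * exp (- d) \<le> c 0"
proof -
  have "1 - 2 * m * d \<le> exp (- (2 * m * d))"
    using exp_ge_add_one_self[of "- (2 * m * d)"] by simp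
  then have "(1 - 2 * m * d) * exp (- d) \<le> exp (- (2 * m * d)) * exp (- d)"
    by (intro mult_right_mono) auto
  also have "\<dots> = exp (\<Sum>i\<in>A. - p i - 2 * m * p i)"
    by (simp add: d_def sum_subtractf sum_negf flip: exp_add sum_distrib_left)
  also have "\<dots> = (\<Prod>i\<in>A. exp (- p i - 2 * m * p i))"
    using fin by (rule exp_sum)
  also have "\<dots> \<le> (\<Prod>i\<in>A. 1 - p i)"
  proof (intro prod_mono conjI)
    fix i assume i: "i \<in> A"
    have "p i * p i \<le> m * p i"
      using p_le[OF i] p_nonneg[OF i] by (rule mult_right_mono)
    then have "- p i - 2 * m * p i \<le> - p i - 2 * (p i)\<^sup>2"
      by (simp add: power2_eq_square)
    also have "\<dots> \<le> ln (1 - p i)"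
      using p_nonneg[OF i] p_le[OF i] m_le by (intro ln_one_minus_pos_lower_bound) auto
    finally have "exp (- p i - 2 * m * p i) \<le> exp (ln (1 - p i))" by simp
    then show "exp (- p i - 2 * m * p i) \<le> 1 - p i"
      using p_le[OF i] m_le by simp
  qed simp
  finally show ?thesis by (simp add: coeff_0_bernoulli_gf)
qed

lemma c_le: "fact k * c k \<le> (d / (1 - m)) ^ k * c 0"
proof (induction k)
  case (Suc k)
  have "fact (Suc k) * c (Suc k) = fact k * (real (Suc k) * c (Suc k))"
    by (simp add: algebra_simps)
  also have "\<dots> \<le> fact k * (d / (1 - m) * c k)"
    by (intro mult_left_mono c_Suc_le) auto
  also have "\<dots> = d / (1 - m) * (fact k * c k)" by simp
  also have "\<dots> \<le> d / (1 - m) * ((d / (1 - m)) ^ k * c 0)"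
    using d_nonneg m_le by (intro mult_left_mono Suc) auto
  finally show ?case by simp
qed simp

text \<open>Fixing the endpoint \<open>k\<close> lets the one factor \<open>d - m * k\<close> serve
  every step up to \<open>k\<close>. The assumption makes it nonnegative, so the inequalities can be
  multiplied.\<close>

lemma c_ge:
  assumes "m * real k \<le> d"
  shows "j \<le> k \<Longrightarrow> (d - m * real k) ^ j * c 0 \<le> fact j * c j"
proof (induction j)
  case (Suc j)
  have "(d - m * real k) ^ Suc j * c 0 = (d - m * real k) * ((d - m * real k) ^ j * c 0)"
    by simp
  also have "\<dots> \<le> (d - m * real k) * (fact j * c j)"
    using assms Suc by (intro mult_left_mono) auto
  also have "\<dots> \<le> (d - m * real j) * (fact j * c j)"
    using m_nonneg Suc.prems c_nonneg by (intro mult_right_mono diff_left_mono mult_left_mono) auto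
  also have "\<dots> = fact j * ((d - m * real j) * c j)" by simp
  also have "\<dots> \<le> fact j * (real (Suc j) * c (Suc j))"
    by (intro mult_left_mono c_Suc_ge) auto
  also have "\<dots> = fact (Suc j) * c (Suc j)"
    by (simp add: algebra_simps)
  finally show ?case .
qed simp

text \<open>Above, the only loss is the factor \<open>(1 - m) ^ k\<close> in the denominator. Below,
  \<open>(1 - m * k / d) ^ k\<close> costs \<delta> and \<open>1 - 2 * m * d\<close> costs
  \<delta>/2. Bernoulli's inequality linearizes both powers.\<close>

lemma poisson_approximation:
  fixes \<delta> :: real
  assumes "k > 0" "d > 0" "2 * d \<le> real k" "\<delta> = m * (real k)\<^sup>2 / d" "\<delta> \<le> 1"
  shows "\<bar>c k / (d ^ k / fact k * exp (- d)) - 1\<bar> \<le> 2 * \<delta>"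
proof -
  let ?w = "d ^ k / fact k * exp (- d)"
  have w: "?w > 0" using assms by simp
  have \<delta>0: "\<delta> \<ge> 0" using assms m_nonneg by simp
  \<comment> \<open>The hypothesis \<open>2 * d \<le> k\<close> replaces one factor \<open>k\<close>
    in \<delta> by \<open>2 * d\<close>.\<close>
  have mk: "m * real k \<le> \<delta> / 2"
  proof -
    have "m * real k * (2 * d) \<le> m * real k * real k"
      using assms m_nonneg by (intro mult_left_mono) auto
    then have "2 * (m * real k) * d \<le> m * (real k)\<^sup>2"
      by (simp add: power2_eq_square mult_ac)
    then have "2 * (m * real k) \<le> \<delta>"
      using assms by (simp only: pos_le_divide_eq)
    then show ?thesis by simp
  qed
  have \<delta>k: "m * real k / d = \<delta> / real k"
    using assms by (simp add: field_simps power2_eq_square)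
  have \<delta>k1: "\<delta> / real k \<le> 1"
    using assms(1,5) by simp
  have "2 * m * d \<le> m * real k"
    using assms m_nonneg mult_left_mono[of "2 * d" "real k" m] by (simp add: mult_ac)
  then have md: "2 * m * d \<le> \<delta> / 2" using mk by linarith

  have upper: "c k \<le> (1 + \<delta>) * ?w"
  proof -
    have "1 - m * real k \<le> (1 - m) ^ k"
      using Bernoulli_inequality[of "- m" k] m_le by (simp add: mult.commute)
    then have b: "1 - \<delta> / 2 \<le> (1 - m) ^ k" using mk by linarith
    \<comment> \<open>The product is \<open>1 + (\<delta> - \<delta>^2) / 2\<close>, so \<delta>
      \<le> 1 turns the lower bound on \<open>(1 - m) ^ k\<close> into an upper bound on its
      inverse.\<close>
    have "1 \<le> (1 + \<delta>) * (1 - \<delta> / 2)"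
      using \<delta>0 assms(5) mult_left_mono[of \<delta> 1 \<delta>] by (simp add: algebra_simps)
    also have "\<dots> \<le> (1 + \<delta>) * (1 - m) ^ k"
      using \<delta>0 b by (intro mult_left_mono) auto
    finally have inv: "1 / (1 - m) ^ k \<le> 1 + \<delta>"
      using m_le by (simp add: field_simps)
    have "fact k * c k \<le> (d / (1 - m)) ^ k * exp (- d)"
      using c_le[of k] mult_left_mono[OF c_0_le, of "(d / (1 - m)) ^ k"] d_nonneg m_le by simp
    also have "\<dots> = (1 / (1 - m) ^ k) * (d ^ k * exp (- d))"
      by (simp add: power_divide)
    also have "\<dots> \<le> (1 + \<delta>) * (d ^ k * exp (- d))"
      using inv d_nonneg by (intro mult_right_mono) auto
    finally show ?thesis by (simp add: field_simps)
  qed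

  have lower: "(1 - 2 * \<delta>) * ?w \<le> c k"
  proof -
    have "1 - \<delta> \<le> (1 - \<delta> / real k) ^ k"
      using Bernoulli_inequality[of "- (\<delta> / real k)" k] \<delta>k1 assms(1) by simp
    then have "(1 - \<delta>) * (1 - 2 * m * d) \<le> (1 - \<delta> / real k) ^ k * (1 - 2 * m * d)"
      using md assms(5) by (intro mult_right_mono) linarith+
    moreover have "(1 - \<delta>) * (1 - \<delta> / 2) \<le> (1 - \<delta>) * (1 - 2 * m * d)"
      using md assms(5) by (intro mult_left_mono) linarith+
    moreover have "1 - 2 * \<delta> \<le> (1 - \<delta>) * (1 - \<delta> / 2)"
      using \<delta>0 by (simp add: algebra_simps)
    ultimately have "1 - 2 * \<delta> \<le> (1 - \<delta> / real k) ^ k * (1 - 2 * m * d)" by linarith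
    then have "(1 - 2 * \<delta>) * (d ^ k * exp (- d))
        \<le> (1 - \<delta> / real k) ^ k * (1 - 2 * m * d) * (d ^ k * exp (- d))"
      using d_nonneg by (intro mult_right_mono) auto
    also have "\<dots> = ((1 - \<delta> / real k) * d) ^ k * ((1 - 2 * m * d) * exp (- d))"
      by (simp add: power_mult_distrib)
    also have "(1 - \<delta> / real k) * d = d - m * real k"
      using assms(2) by (simp add: algebra_simps flip: \<delta>k)
    also have mkd: "m * real k \<le> d"
      using \<delta>k1 assms(2) by (simp add: pos_divide_le_eq flip: \<delta>k)
    then have "(d - m * real k) ^ k * ((1 - 2 * m * d) * exp (- d)) \<le> (d - m * real k) ^ k * c 0"
      by (intro mult_left_mono c_0_ge) auto
    also have "\<dots> \<le> fact k * c k"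
      by (rule c_ge[OF mkd order_refl])
    finally show ?thesis by (simp add: field_simps)
  qed

  have "c k / ?w \<le> 1 + \<delta>" "1 - 2 * \<delta> \<le> c k / ?w"
    using upper lower w by (simp_all only: pos_divide_le_eq pos_le_divide_eq)
  then show ?thesis using \<delta>0 by linarith
qed

section \<open>Geometric decay of the tail\<close>

lemma c_Suc_le_ratio:
  assumes "k \<le> j"
  shows "c (Suc j) \<le> d / ((1 - m) * real (Suc k)) * c j"
proof -
  \<comment> \<open>Freezing the index at \<open>k\<close> makes the ratio independent of
    \<open>j\<close>.\<close>
  have "real (Suc k) * c (Suc j) \<le> real (Suc j) * c (Suc j)"
    using assms c_nonneg by (intro mult_right_mono) auto
  also have "\<dots> \<le> d / (1 - m) * c j" by (rule c_Suc_le)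
  finally have "c (Suc j) \<le> d / (1 - m) * c j / real (Suc k)"
    by (simp only: pos_le_divide_eq of_nat_0_less_iff mult.commute zero_less_Suc)
  then show ?thesis by simp
qed

end

text \<open>No series is evaluated: shifting the tail by one bounds it by \<open>r\<close> times the
  mass of \<open>{k..}\<close>, which is \<open>pmf X k\<close> plus the same tail, and the
  resulting linear inequality is solved.\<close>

lemma pmf_tail_le_geometric:
  fixes X :: "nat pmf"
  assumes ratio: "\<And>j. k \<le> j \<Longrightarrow> pmf X (Suc j) \<le> r * pmf X j"
    and r: "0 \<le> r" "r < 1"
  shows "measure_pmf.prob X {k<..} \<le> r / (1 - r) * pmf X k"
proof -
  let ?t = "measure_pmf.prob X {k<..}"
  have bij: "bij_betw Suc {k..} {k<..}"
    by (rule bij_betwI[where g = "\<lambda>j. j - 1"]) auto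
  have "?t = infsetsum (\<lambda>j. pmf X (Suc j)) {k..}"
    by (simp add: measure_pmf_conv_infsetsum infsetsum_reindex_bij_betw[OF bij])
  also have "\<dots> \<le> infsetsum (\<lambda>j. r * pmf X j) {k..}"
    using ratio
    by (intro infsetsum_mono abs_summable_on_cmult_right pmf_abs_summable)
       (auto simp: abs_summable_on_reindex_bij_betw[OF bij])
  also have "\<dots> = r * measure_pmf.prob X {k..}"
    by (simp add: infsetsum_cmult_right pmf_abs_summable measure_pmf_conv_infsetsum)
  also have "{k..} = insert k {k<..}" by auto
  also have "measure_pmf.prob X (insert k {k<..}) = pmf X k + ?t"
    by (subst measure_pmf.finite_measure_Union[of "{k}" X "{k<..}", simplified])
       (auto simp: measure_pmf_single)
  finally have "(1 - r) * ?t \<le> r * pmf X k" by (simp add: algebra_simps)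
  then show ?thesis using r by (simp add: field_simps)
qed

theorem theorem3p1:
  shows "\<exists>C::real. C > 0 \<and>
    (\<forall>(n::nat) (p :: nat \<Rightarrow> real) (X :: nat pmf) (Y :: nat pmf) (d::real) (pmax::real) (k::nat).
       (\<forall>i\<in>{1..n}. 0 \<le> p i \<and> p i \<le> 1) \<longrightarrow>
       X = Bin_pmf n p \<longrightarrow>
       d = (\<Sum>i=1..n. p i) \<longrightarrow>
       d > 0 \<longrightarrow>
       pmax = Max (p ` {1..n}) \<longrightarrow>
       Y = poisson_pmf d \<longrightarrow>
       2 * d \<le> real k \<longrightarrow>
       real k \<le> (d / pmax) powr (2/5) / C \<longrightarrow>
         \<bar>pmf X k / pmf Y k - 1\<bar> \<le> C * (pmax * real k powr (5/2) / d) \<and>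
         measure_pmf.prob X {k<..} \<le> C * (d / real k + pmax * real k powr (5/2) / d) * pmf X k)"
proof (rule exI[of _ 4], intro conjI allI impI)
  \<comment> \<open>With the constant 4 the range condition gives \<epsilon> \<le> 1/4, which keeps
    \<delta> and \<open>pmax\<close> at most 1/4. The value 4 itself reappears in the tail bound as
    \<open>3 * (4/3)\<close>.\<close>
  fix n :: nat and p :: "nat \<Rightarrow> real" and X Y :: "nat pmf" and d pmax :: real and k :: nat
  assume p: "\<forall>i\<in>{1..n}. 0 \<le> p i \<and> p i \<le> 1" and X: "X = Bin_pmf n p"
    and d: "d = (\<Sum>i=1..n. p i)" and d_pos: "d > 0" and pmax: "pmax = Max (p ` {1..n})"
    and Y: "Y = poisson_pmf d" and k_ge: "2 * d \<le> real k"
    and k_le: "real k \<le> (d / pmax) powr (2/5) / 4"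
  \<comment> \<open>\<epsilon> is the error term of the statement; \<delta>, with exponent 2 in
    place of 5/2, is the smaller error delivered by \<open>poisson_approximation\<close>.\<close>
  define \<epsilon> where "\<epsilon> = pmax * real k powr (5/2) / d"
  define \<delta> where "\<delta> = pmax * (real k)\<^sup>2 / d"
  have k: "k > 0" using d_pos k_ge by (cases k) auto
  have p_le: "p i \<le> pmax" if "i \<in> {1..n}" for i
    unfolding pmax using that by (intro Max_ge) auto
  have pmax_pos: "pmax > 0"
  proof (rule ccontr)
    assume "\<not> pmax > 0"
    then have "d \<le> 0" unfolding d using p_le by (intro sum_nonpos) force
    then show False using d_pos by simp
  qed
  \<comment> \<open>The range condition is raised to the power 5/2; the crude bound
    \<open>4 \<le> 4 powr (5/2)\<close> suffices.\<close>
  have "4 * real k powr (5/2) \<le> (4 * real k) powr (5/2)"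
    using powr_mono[of 1 "5/2" "4::real"] by (simp add: powr_mult mult_right_mono)
  also have "\<dots> \<le> ((d / pmax) powr (2/5)) powr (5/2)"
    using k_le by (intro powr_mono2) auto
  also have "\<dots> = d / pmax"
    using d_pos pmax_pos by (simp add: powr_powr)
  finally have \<epsilon>_le: "\<epsilon> \<le> 1/4"
    using d_pos pmax_pos by (simp add: \<epsilon>_def field_simps)
  have "(real k)\<^sup>2 \<le> real k powr (5/2)"
    using k powr_mono[of 2 "5/2" "real k"] by (simp add: powr_numeral)
  then have \<delta>_le: "\<delta> \<le> \<epsilon>"
    using d_pos pmax_pos by (simp add: \<delta>_def \<epsilon>_def divide_right_mono)
  have pmax_le: "pmax \<le> 1/4"
  proof -
    \<comment> \<open>From \<open>d \<le> k^2\<close> it follows that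
      \<open>pmax \<le> \<delta>\<close>, so smallness of \<delta> alone bounds
      \<open>pmax\<close>.\<close>
    have "d \<le> (real k)\<^sup>2"
      using k_ge k d_pos self_le_power[of "real k" 2] by linarith
    then have "pmax * d \<le> pmax * (real k)\<^sup>2"
      using pmax_pos by simp
    then have "pmax \<le> \<delta>"
      using d_pos by (simp add: \<delta>_def field_simps)
    then show ?thesis using \<delta>_le \<epsilon>_le by linarith
  qed
  interpret bernoulli_family p "{1..n}" pmax
    using p p_le pmax_pos pmax_le by unfold_locales auto
  \<comment> \<open>The fixed variable \<open>d\<close> hides the constant \<open>d\<close> of the
    locale; this equation translates the locale's lemmas.\<close>
  have d_eq: "bernoulli_family.d p {1..n} = d"
    unfolding d_def d ..
  have X_eq: "pmf X j = c j" for j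
    unfolding X Bin_pmf_def using p by (intro pmf_sum_bernoulli) auto
  have "\<bar>pmf X k / pmf Y k - 1\<bar> \<le> 2 * \<delta>"
    unfolding Y X_eq pmf_poisson[OF d_pos]
    using k d_pos k_ge \<delta>_def \<delta>_le \<epsilon>_le
    by (intro poisson_approximation[unfolded d_eq]) linarith+
  moreover have \<epsilon>_pos: "\<epsilon> \<ge> 0" using d_pos pmax_pos by (simp add: \<epsilon>_def)
  ultimately show "\<bar>pmf X k / pmf Y k - 1\<bar> \<le> 4 * (pmax * real k powr (5/2) / d)"
    using \<delta>_le unfolding \<epsilon>_def[symmetric] by linarith

  define r where "r = d / ((1 - pmax) * real (Suc k))"
  have r0: "r \<ge> 0" using d_pos pmax_le by (simp add: r_def)
  have r_le: "r \<le> 4/3 * (d / real k)"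
  proof -
    have "3/4 * real k \<le> (1 - pmax) * real (Suc k)"
      using pmax_le by (intro mult_mono) auto
    then have "r \<le> d / (3/4 * real k)"
      unfolding r_def using d_pos k pmax_le by (intro divide_left_mono mult_pos_pos) auto
    then show ?thesis by simp
  qed
  have "d / real k \<le> 1/2" using k_ge k by (simp add: field_simps)
  then have r1: "r \<le> 2/3" using r_le by linarith
  have tail: "measure_pmf.prob X {k<..} \<le> r / (1 - r) * pmf X k"
  proof (rule pmf_tail_le_geometric)
    show "pmf X (Suc j) \<le> r * pmf X j" if "k \<le> j" for j
      unfolding X_eq r_def by (rule c_Suc_le_ratio[unfolded d_eq, OF that])
  qed (use r0 r1 in auto)
  \<comment> \<open>From \<open>r \<le> 2/3\<close> the denominator is at least 1/3.\<close>
  have "r / (1 - r) \<le> 3 * r"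
    using mult_left_mono[OF r1 r0] r1 by (simp add: field_simps)
  also have "3 * r \<le> 3 * (4/3 * (d / real k))"
    using r_le by (intro mult_left_mono) auto
  also have "\<dots> \<le> 4 * (d / real k + \<epsilon>)"
    using \<epsilon>_pos by simp
  finally have "r / (1 - r) * pmf X k \<le> 4 * (d / real k + \<epsilon>) * pmf X k"
    by (intro mult_right_mono) auto
  with tail show "measure_pmf.prob X {k<..}
      \<le> 4 * (d / real k + pmax * real k powr (5/2) / d) * pmf X k"
    unfolding \<epsilon>_def by (rule order_trans)
qed simp

end
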